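(* Consider the first-order splitting time discretization (implicit relaxation step followed by forward Euler transport step), combined with the finite volume space discretization with either the first-order or the second-order numerical flux, as described in the context. This scheme is positivity preserving, i.e. if $f_{i,k}^\ell(\mathbf v)\ge0$ for $i=1,2$, all cells $k$ and all $\mathbf v\in V$, then $f_{i,k}^{\ell+1}(\mathbf v)\ge0$ for $i=1,2$, all $k$ and all $\mathbf v\in V$, provided that $$\Delta t\le\alpha\,\frac{\Delta x}{\max_{\mathbf v\in V}|v^1|},$$ with $\alpha=1$ for the first-order flux and $\alpha=\frac23$ for the second-order flux.
   Context: Species $i\in\{1,2\}$, with $j$ the other index; masses $m_i>0$. Velocities $\mathbf v=(v^1,v^2,v^3)$ range over a velocity domain $V\subset\mathbb R^3$ with $\max_V|v^1|<\infty$; velocity integrals are over $V$. Space is one-dimensional with cells $k\in\{0,\dots,K\}$ of width $\Delta x>0$; $\Delta t>0$. Notation: $\mathbf a_i(\mathbf v)=m_i(1,\mathbf v,|\mathbf v|^2)^\top$, $\mathbf a_{12}=m_1(1,0,\mathbf v,|\mathbf v|^2)^\top$, $\mathbf a_{21}=m_2(0,1,\mathbf v,|\mathbf v|^2)^\top$, $\Lambda=\mathbb R\times\mathbb R^3\times(-\infty,0)$, $\Lambda_{12}=\mathbb R\times\mathbb R\times\mathbb R^3\times(-\infty,0)$. Relaxation step (in each cell $k$; index $k$ suppressed). The collision frequencies $\nu_{ij}=\nu_{ij}^\ell(\mathbf v)\ge0$ are given functions of $\mathbf v$. With $c_i=\frac1{1+\Delta t(\nu_{ii}+\nu_{ij})}$,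 $$f_i^{\ell'}=c_if_i^\ell+c_i\Delta t(\nu_{ii}A_{ii}+\nu_{ij}A_{ij}),$$ where $A_{ii}=e^{\boldsymbol\lambda_i\cdot\mathbf a_i}$, $A_{12}=e^{\boldsymbol\lambda\cdot\mathbf a_{12}}$, $A_{21}=e^{\boldsymbol\lambda\cdot\mathbf a_{21}}$, $\boldsymbol\lambda_i$ is the minimizer over $\boldsymbol\alpha\in\Lambda$ of $\int c_i\nu_{ii}e^{\boldsymbol\alpha\cdot\mathbf a_i}d\mathbf v-\boldsymbol\alpha\cdot\int c_i\nu_{ii}f_i^\ell\mathbf a_i\,d\mathbf v$, and $\boldsymbol\lambda$ is the minimizer over $\boldsymbol\alpha\in\Lambda_{12}$ of $\int[c_1\nu_{12}e^{\boldsymbol\alpha\cdot\mathbf a_{12}}+c_2\nu_{21}e^{\boldsymbol\alpha\cdot\mathbf a_{21}}]d\mathbf v-\boldsymbol\alpha\cdot\int[c_1\nu_{12}f_1^\ell\mathbf a_{12}+c_2\nu_{21}f_2^\ell\mathbf a_{21}]d\mathbf v$. Standing assumption: these integrals are finite and the minimizers exist and are unique. Transport step. For each $\mathbf v$, $$f_{i,k}^{\ell+1}=f_{i,k}^{\ell'}-\frac{\Delta t}{\Delta x}\big(\mathscr F_{k+\frac12}(f_i^{\ell'})-\mathscr F_{k-\frac12}(f_i^{\ell'})\big),$$ $$\mathscr F_{k+\frac12}(g)=\frac{v^1}2(g_{k+1}+g_k)-\frac{|v^1|}2\big(g_{k+1}-g_k-\phi_{k+\frac12}(g)\big).$$ First-order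 flux: $\phi_{k+\frac12}=0$. Second-order flux: $\phi_{k+\frac12}(g)=\operatorname{minmod}(g_k-g_{k-1},\,g_{k+1}-g_k,\,g_{k+2}-g_{k+1})$, where $\operatorname{minmod}(a,b,c)=s\min(|a|,|b|,|c|)$ if $\operatorname{sign}a=\operatorname{sign}b=\operatorname{sign}c=:s$ and $0$ otherwise. Values of $f_i^{\ell'}$ in ghost cells outside $\{0,\dots,K\}$ needed by the fluxes are prescribed by boundary conditions and are nonnegative (e.g. periodic extension). *)

theory Defs
  imports "HOL-Analysis.Analysis"
begin

section \<open>Species and velocity weights\<close>

datatype species = Sp1 | Sp2

fun other :: "species \<Rightarrow> species" where
  "other Sp1 = Sp2"
| "other Sp2 = Sp1"

text \<open>The weights take values in product spaces, whose inner product is the sum of the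
  componentwise inner products.\<close>

definition a_self :: "(species \<Rightarrow> real) \<Rightarrow> species \<Rightarrow> real^3 \<Rightarrow> real \<times> (real^3) \<times> real" where
  "a_self m i v = m i *\<^sub>R (1, v, (norm v)\<^sup>2)"

text \<open>\<open>a_cross m Sp1\<close> is $\mathbf a_{12}$ and \<open>a_cross m Sp2\<close> is $\mathbf a_{21}$.\<close>

fun a_cross :: "(species \<Rightarrow> real) \<Rightarrow> species \<Rightarrow> real^3 \<Rightarrow> real \<times> real \<times> (real^3) \<times> real" where
  "a_cross m Sp1 v = m Sp1 *\<^sub>R (1, 0, v, (norm v)\<^sup>2)"
| "a_cross m Sp2 v = m Sp2 *\<^sub>R (0, 1, v, (norm v)\<^sup>2)"

definition Lambda_self :: "(real \<times> (real^3) \<times> real) set" where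
  "Lambda_self = UNIV \<times> UNIV \<times> {..<0}"

definition Lambda_cross :: "(real \<times> real \<times> (real^3) \<times> real) set" where
  "Lambda_cross = UNIV \<times> UNIV \<times> UNIV \<times> {..<0}"

section \<open>Relaxation step in one cell\<close>

text \<open>Here \<open>\<nu> i j\<close> and \<open>f i\<close> are the collision frequencies and the distribution
  functions in one fixed cell.\<close>

definition relax_coeff ::
  "real \<Rightarrow> (species \<Rightarrow> species \<Rightarrow> real^3 \<Rightarrow> real) \<Rightarrow> species \<Rightarrow> real^3 \<Rightarrow> real" where
  "relax_coeff dt \<nu> i v = 1 / (1 + dt * (\<nu> i i v + \<nu> i (other i) v))"

definition exp_self ::
  "real \<Rightarrow> (species \<Rightarrow> real) \<Rightarrow> (species \<Rightarrow> species \<Rightarrow> real^3 \<Rightarrow> real) \<Rightarrow>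
   species \<Rightarrow> real \<times> (real^3) \<times> real \<Rightarrow> real^3 \<Rightarrow> real" where
  "exp_self dt m \<nu> i \<alpha> v = relax_coeff dt \<nu> i v * \<nu> i i v * exp (\<alpha> \<bullet> a_self m i v)"

definition moment_self ::
  "real \<Rightarrow> (species \<Rightarrow> real) \<Rightarrow> (species \<Rightarrow> species \<Rightarrow> real^3 \<Rightarrow> real) \<Rightarrow>
   (species \<Rightarrow> real^3 \<Rightarrow> real) \<Rightarrow> species \<Rightarrow> real^3 \<Rightarrow> real \<times> (real^3) \<times> real" where
  "moment_self dt m \<nu> f i v = (relax_coeff dt \<nu> i v * \<nu> i i v * f i v) *\<^sub>R a_self m i v"

definition exp_cross ::
  "real \<Rightarrow> (species \<Rightarrow> real) \<Rightarrow> (species \<Rightarrow> species \<Rightarrow> real^3 \<Rightarrow> real) \<Rightarrow>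
   real \<times> real \<times> (real^3) \<times> real \<Rightarrow> real^3 \<Rightarrow> real" where
  "exp_cross dt m \<nu> \<alpha> v =
     relax_coeff dt \<nu> Sp1 v * \<nu> Sp1 Sp2 v * exp (\<alpha> \<bullet> a_cross m Sp1 v)
   + relax_coeff dt \<nu> Sp2 v * \<nu> Sp2 Sp1 v * exp (\<alpha> \<bullet> a_cross m Sp2 v)"

definition moment_cross ::
  "real \<Rightarrow> (species \<Rightarrow> real) \<Rightarrow> (species \<Rightarrow> species \<Rightarrow> real^3 \<Rightarrow> real) \<Rightarrow>
   (species \<Rightarrow> real^3 \<Rightarrow> real) \<Rightarrow> real^3 \<Rightarrow> real \<times> real \<times> (real^3) \<times> real" where
  "moment_cross dt m \<nu> f v =
     (relax_coeff dt \<nu> Sp1 v * \<nu> Sp1 Sp2 v * f Sp1 v) *\<^sub>R a_cross m Sp1 v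
   + (relax_coeff dt \<nu> Sp2 v * \<nu> Sp2 Sp1 v * f Sp2 v) *\<^sub>R a_cross m Sp2 v"

definition potential_self ::
  "(real^3) set \<Rightarrow> real \<Rightarrow> (species \<Rightarrow> real) \<Rightarrow> (species \<Rightarrow> species \<Rightarrow> real^3 \<Rightarrow> real) \<Rightarrow>
   (species \<Rightarrow> real^3 \<Rightarrow> real) \<Rightarrow> species \<Rightarrow> real \<times> (real^3) \<times> real \<Rightarrow> real" where
  "potential_self V dt m \<nu> f i \<alpha> =
     (LINT v:V|lebesgue. exp_self dt m \<nu> i \<alpha> v)
     - \<alpha> \<bullet> (LINT v:V|lebesgue. moment_self dt m \<nu> f i v)"

definition potential_cross ::
  "(real^3) set \<Rightarrow> real \<Rightarrow> (species \<Rightarrow> real) \<Rightarrow> (species \<Rightarrow> species \<Rightarrow> real^3 \<Rightarrow> real) \<Rightarrow>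
   (species \<Rightarrow> real^3 \<Rightarrow> real) \<Rightarrow> real \<times> real \<times> (real^3) \<times> real \<Rightarrow> real" where
  "potential_cross V dt m \<nu> f \<alpha> =
     (LINT v:V|lebesgue. exp_cross dt m \<nu> \<alpha> v)
     - \<alpha> \<bullet> (LINT v:V|lebesgue. moment_cross dt m \<nu> f v)"

text \<open>The standing assumption: the integrals are finite and each potential has exactly one
  minimizer. It makes the choice in \<^const>\<open>arg_min_on\<close> below unambiguous.\<close>

definition relaxation_well_posed ::
  "(real^3) set \<Rightarrow> real \<Rightarrow> (species \<Rightarrow> real) \<Rightarrow> (species \<Rightarrow> species \<Rightarrow> real^3 \<Rightarrow> real) \<Rightarrow>
   (species \<Rightarrow> real^3 \<Rightarrow> real) \<Rightarrow> bool" where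
  "relaxation_well_posed V dt m \<nu> f \<longleftrightarrow>
     (\<forall>i. (\<forall>\<alpha>\<in>Lambda_self. set_integrable lebesgue V (exp_self dt m \<nu> i \<alpha>))
        \<and> set_integrable lebesgue V (moment_self dt m \<nu> f i)
        \<and> (\<exists>!\<alpha>. is_arg_min (potential_self V dt m \<nu> f i) (\<lambda>\<beta>. \<beta> \<in> Lambda_self) \<alpha>))
   \<and> (\<forall>\<alpha>\<in>Lambda_cross. set_integrable lebesgue V (exp_cross dt m \<nu> \<alpha>))
   \<and> set_integrable lebesgue V (moment_cross dt m \<nu> f)
   \<and> (\<exists>!\<alpha>. is_arg_min (potential_cross V dt m \<nu> f) (\<lambda>\<beta>. \<beta> \<in> Lambda_cross) \<alpha>)"

definition target_self ::
  "(real^3) set \<Rightarrow> real \<Rightarrow> (species \<Rightarrow> real) \<Rightarrow> (species \<Rightarrow> species \<Rightarrow> real^3 \<Rightarrow> real) \<Rightarrow>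
   (species \<Rightarrow> real^3 \<Rightarrow> real) \<Rightarrow> species \<Rightarrow> real^3 \<Rightarrow> real" where
  "target_self V dt m \<nu> f i v =
     exp (arg_min_on (potential_self V dt m \<nu> f i) Lambda_self \<bullet> a_self m i v)"

text \<open>\<open>target_cross\<close> at \<open>Sp1\<close> is $A_{12}$ and at \<open>Sp2\<close> is $A_{21}$;
  both use the same multiplier.\<close>

definition target_cross ::
  "(real^3) set \<Rightarrow> real \<Rightarrow> (species \<Rightarrow> real) \<Rightarrow> (species \<Rightarrow> species \<Rightarrow> real^3 \<Rightarrow> real) \<Rightarrow>
   (species \<Rightarrow> real^3 \<Rightarrow> real) \<Rightarrow> species \<Rightarrow> real^3 \<Rightarrow> real" where
  "target_cross V dt m \<nu> f i v =
     exp (arg_min_on (potential_cross V dt m \<nu> f) Lambda_cross \<bullet> a_cross m i v)"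

definition relaxation_step ::
  "(real^3) set \<Rightarrow> real \<Rightarrow> (species \<Rightarrow> real) \<Rightarrow> (species \<Rightarrow> species \<Rightarrow> real^3 \<Rightarrow> real) \<Rightarrow>
   (species \<Rightarrow> real^3 \<Rightarrow> real) \<Rightarrow> species \<Rightarrow> real^3 \<Rightarrow> real" where
  "relaxation_step V dt m \<nu> f i v =
     relax_coeff dt \<nu> i v * f i v
     + relax_coeff dt \<nu> i v * dt *
       (\<nu> i i v * target_self V dt m \<nu> f i v + \<nu> i (other i) v * target_cross V dt m \<nu> f i v)"

section \<open>Transport step\<close>

datatype flux_order = First_Order | Second_Order

definition minmod :: "real \<Rightarrow> real \<Rightarrow> real \<Rightarrow> real" where
  "minmod a b c =
     (if sgn a = sgn b \<and> sgn b = sgn c then sgn a * min \<bar>a\<bar> (min \<bar>b\<bar> \<bar>c\<bar>) else 0)"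

text \<open>The index \<open>k\<close> in \<open>flux_limiter\<close> and \<open>num_flux\<close> stands for the interface
  $k+\frac12$; \<open>w\<close> is the velocity component $v^1$.\<close>

fun flux_limiter :: "flux_order \<Rightarrow> (int \<Rightarrow> real) \<Rightarrow> int \<Rightarrow> real" where
  "flux_limiter First_Order g k = 0"
| "flux_limiter Second_Order g k = minmod (g k - g (k-1)) (g (k+1) - g k) (g (k+2) - g (k+1))"

definition num_flux :: "flux_order \<Rightarrow> real \<Rightarrow> (int \<Rightarrow> real) \<Rightarrow> int \<Rightarrow> real" where
  "num_flux q w g k =
     w / 2 * (g (k+1) + g k) - \<bar>w\<bar> / 2 * (g (k+1) - g k - flux_limiter q g k)"

definition transport_step ::
  "flux_order \<Rightarrow> real \<Rightarrow> real \<Rightarrow> real \<Rightarrow> (int \<Rightarrow> real) \<Rightarrow> int \<Rightarrow> real" where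
  "transport_step q dt dx w g k = g k - dt / dx * (num_flux q w g k - num_flux q w g (k-1))"

text \<open>The cells outside \<open>{0..K}\<close> that enter the fluxes at the interfaces
  $-\frac12,\dots,K+\frac12$.\<close>

fun ghost_cells :: "flux_order \<Rightarrow> nat \<Rightarrow> int set" where
  "ghost_cells First_Order K = {-1, int K + 1}"
| "ghost_cells Second_Order K = {-2, -1, int K + 1, int K + 2}"

fun cfl_const :: "flux_order \<Rightarrow> real" where
  "cfl_const First_Order = 1"
| "cfl_const Second_Order = 2/3"

definition vmax :: "(real^3) set \<Rightarrow> real" where
  "vmax V = (SUP v\<in>V. \<bar>v $ 1\<bar>)"

text \<open>If \<^term>\<open>vmax V = 0\<close>, the bound on the time step is $+\infty$, i.e. void, whereas
  division in HOL would give the bound 0.\<close>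

definition cfl_condition :: "flux_order \<Rightarrow> (real^3) set \<Rightarrow> real \<Rightarrow> real \<Rightarrow> bool" where
  "cfl_condition q V dt dx \<longleftrightarrow> vmax V = 0 \<or> dt \<le> cfl_const q * (dx / vmax V)"

end

theory Submission imports Defs begin

text \<open>The relaxation step is a combination of nonnegative quantities with nonnegative
  coefficients. With $c = |v^1| \Delta t / \Delta x$ and $g_u$ the value in the upwind neighbour
  of cell $k$, the transport step reads
  $(1 - c) g_k + c g_u - \frac c2 (\phi_{k+1/2} - \phi_{k-1/2})$. Both limiters lie between $0$ and
  the jump between cell $k$ and its upwind neighbour, so their difference is at most
  $|g_k - g_u|$ in absolute value. In the worst case, $g_k > g_u$, this leaves
  $(1 - \frac32 c) g_k + \frac32 c g_u$, which is nonnegative for $c \le \frac23$.\<close>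

lemma relax_coeff_nonneg:
  assumes "dt \<ge> 0" "\<And>j. \<nu> i j v \<ge> 0"
  shows "relax_coeff dt \<nu> i v \<ge> 0"
  using assms by (simp add: relax_coeff_def)

text \<open>Both targets are exponentials, hence positive for every value of the
  multipliers.\<close>

lemma relaxation_step_nonneg:
  assumes "dt \<ge> 0" "\<And>j. \<nu> i j v \<ge> 0" "f i v \<ge> 0"
  shows "relaxation_step V dt m \<nu> f i v \<ge> 0"
  using assms relax_coeff_nonneg[of dt \<nu> i v]
  by (simp add: relaxation_step_def target_self_def target_cross_def)

text \<open>A nonzero \<open>minmod\<close> has the common sign of its arguments and the smallest of
  their moduli, so it cannot overshoot any of them.\<close>

lemma minmod_bounds:
  assumes "d \<in> {a, b, c}"
  shows "min 0 d \<le> minmod a b c" "minmod a b c \<le> max 0 d"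
  using assms by (auto simp: minmod_def sgn_if split: if_splits)

lemma flux_limiter_bounds:
  assumes "i \<in> {k - 1, k, k + 1}"
  shows "min 0 (g (i + 1) - g i) \<le> flux_limiter q g k"
    and "flux_limiter q g k \<le> max 0 (g (i + 1) - g i)"
proof -
  have *: "g (i + 1) - g i \<in> {g k - g (k - 1), g (k + 1) - g k, g (k + 2) - g (k + 1)}"
    using assms by (auto simp: add.commute)
  show "min 0 (g (i + 1) - g i) \<le> flux_limiter q g k"
    by (cases q) (use minmod_bounds(1)[OF *] in auto)
  show "flux_limiter q g k \<le> max 0 (g (i + 1) - g i)"
    by (cases q) (use minmod_bounds(2)[OF *] in auto)
qed

text \<open>The limiters at the two faces of cell \<open>k\<close> have the jumps across both faces
  as common arguments. Either jump therefore confines both limiters to one interval of length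
  \<open>\<bar>g (i + 1) - g i\<bar>\<close>.\<close>

lemma flux_limiter_diff_bound:
  assumes "i \<in> {k - 1, k}"
  shows "\<bar>flux_limiter q g k - flux_limiter q g (k - 1)\<bar> \<le> \<bar>g (i + 1) - g i\<bar>"
proof -
  have i: "i \<in> {k - 1, k, k + 1}" "i \<in> {k - 1 - 1, k - 1, k - 1 + 1}"
    using assms by auto
  show ?thesis
    using flux_limiter_bounds[OF i(1), where g = g and q = q]
      flux_limiter_bounds[OF i(2), where g = g and q = q]
    by linarith
qed

text \<open>Without its limiter term, the flux at the right face of cell \<open>k\<close> collapses
  to \<open>w * g k\<close> for \<open>w \<ge> 0\<close> and to \<open>w * g (k + 1)\<close> for
  \<open>w < 0\<close>.\<close>

lemma transport_step_upwind:
  fixes g :: "int \<Rightarrow> real"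
  defines "u \<equiv> \<lambda>w k. if w \<ge> (0::real) then g (k - 1) else g (k + 1)"
  shows "transport_step q dt dx w g k =
    (1 - dt / dx * \<bar>w\<bar>) * g k + dt / dx * \<bar>w\<bar> * u w k
    - dt / dx * \<bar>w\<bar> / 2 * (flux_limiter q g k - flux_limiter q g (k - 1))"
proof -
  define s where "s = dt / dx"
  show ?thesis
    unfolding transport_step_def num_flux_def u_def s_def[symmetric]
    by (cases "w \<ge> 0") (simp_all add: field_simps)
qed

lemma upwind_nonneg:
  fixes c x y D :: real
  assumes "x \<ge> 0" "y \<ge> 0" "0 \<le> c" "c \<le> 2 / 3" "\<bar>D\<bar> \<le> \<bar>x - y\<bar>"
  shows "(1 - c) * x + c * y - c / 2 * D \<ge> 0"
proof -
  have "c / 2 * D \<le> c / 2 * \<bar>x - y\<bar>"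
    using assms by (intro mult_left_mono) auto
  moreover have "(1 - c) * x + c * y - c / 2 * \<bar>x - y\<bar> \<ge> 0"
  proof (cases "x \<ge> y")
    case True
    \<comment> \<open>The limiter term shifts a further weight \<open>c / 2\<close> from
      \<open>x\<close> to \<open>y\<close>; the first coefficient is the source of the constant
      2/3.\<close>
    have "(1 - 3 / 2 * c) * x + 3 / 2 * c * y \<ge> 0"
      using assms by (intro add_nonneg_nonneg mult_nonneg_nonneg) auto
    with True show ?thesis by (simp add: field_simps)
  next
    case False
    \<comment> \<open>Here the limiter term returns weight \<open>c / 2\<close> from
      \<open>y\<close> to \<open>x\<close>.\<close>
    have "(1 - c / 2) * x + c / 2 * y \<ge> 0"
      using assms by (intro add_nonneg_nonneg mult_nonneg_nonneg) auto
    with False show ?thesis by (simp add: field_simps)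
  qed
  ultimately show ?thesis by linarith
qed

lemma transport_step_nonneg:
  assumes "dt \<ge> 0" "dx \<ge> 0"
    and cfl: "dt / dx * \<bar>w\<bar> \<le> cfl_const q"
    and g: "g (k - 1) \<ge> 0" "g k \<ge> 0" "g (k + 1) \<ge> 0"
  shows "transport_step q dt dx w g k \<ge> 0"
proof -
  define c where "c = dt / dx * \<bar>w\<bar>"
  define y where "y = (if w \<ge> 0 then g (k - 1) else g (k + 1))"
  define D where "D = flux_limiter q g k - flux_limiter q g (k - 1)"
  have step: "transport_step q dt dx w g k = (1 - c) * g k + c * y - c / 2 * D"
    unfolding c_def y_def D_def by (rule transport_step_upwind)
  have c: "0 \<le> c" "c \<le> cfl_const q" and y: "y \<ge> 0"
    using assms by (auto simp: c_def y_def)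
  show ?thesis
  proof (cases q)
    case First_Order
    then show ?thesis
      using c y g step by (simp add: D_def)
  next
    case Second_Order
    have "\<bar>D\<bar> \<le> \<bar>g k - y\<bar>"
      \<comment> \<open>The upwind jump is the one across the left face (\<open>i = k - 1\<close>)
        for \<open>w \<ge> 0\<close> and across the right face (\<open>i = k\<close>)
        otherwise.\<close>
      using flux_limiter_diff_bound[of "k - 1" k q g] flux_limiter_diff_bound[of k k q g]
      by (auto simp: D_def y_def abs_minus_commute)
    with Second_Order show ?thesis
      using upwind_nonneg[of "g k" y c D] c y g step by simp
  qed
qed

lemma cfl_condition_pointwise:
  assumes bdd: "bdd_above ((\<lambda>v. \<bar>v $ 1\<bar>) ` V)" and "v \<in> V" "dt \<ge> 0" "dx > 0"
    and cfl: "cfl_condition q V dt dx"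
  shows "dt / dx * \<bar>v $ 1\<bar> \<le> cfl_const q"
proof -
  have v: "\<bar>v $ 1\<bar> \<le> vmax V"
    unfolding vmax_def by (rule cSUP_upper[OF \<open>v \<in> V\<close> bdd])
  show ?thesis
  proof (cases "vmax V = 0")
    \<comment> \<open>All of \<open>V\<close> then has \<open>v $ 1 = 0\<close>, so the Courant
      number vanishes for every time step.\<close>
    case True
    with v show ?thesis by (cases q) auto
  next
    case False
    with v have pos: "vmax V > 0" by linarith
    have "dt / dx * \<bar>v $ 1\<bar> \<le> dt / dx * vmax V"
      using v assms by (intro mult_left_mono) auto
    also have "\<dots> \<le> cfl_const q"
      using cfl False pos \<open>dx > 0\<close> by (simp add: cfl_condition_def field_simps)
    finally show ?thesis .
  qed
qed

theorem proposition5p1: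
  fixes V :: "(real^3) set"
    and m :: "species \<Rightarrow> real"
    and K :: nat
    and dt dx :: real
    and q :: flux_order
    and \<nu> :: "int \<Rightarrow> species \<Rightarrow> species \<Rightarrow> real^3 \<Rightarrow> real"
    and f f_relax f_new :: "int \<Rightarrow> species \<Rightarrow> real^3 \<Rightarrow> real"
  assumes V_meas: "V \<in> sets lebesgue"
    and V_bdd: "bdd_above ((\<lambda>v. \<bar>v $ 1\<bar>) ` V)"
    and mass_pos: "\<And>i. m i > 0"
    and dt_pos: "dt > 0"
    and dx_pos: "dx > 0"
    and nu_nonneg: "\<And>k i j v. k \<in> {0..int K} \<Longrightarrow> v \<in> V \<Longrightarrow> \<nu> k i j v \<ge> 0"
    and well_posed: "\<And>k. k \<in> {0..int K} \<Longrightarrow> relaxation_well_posed V dt m (\<nu> k) (f k)"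
    and relaxation: "\<And>k i v. k \<in> {0..int K} \<Longrightarrow> v \<in> V \<Longrightarrow>
          f_relax k i v = relaxation_step V dt m (\<nu> k) (f k) i v"
    and ghost_nonneg: "\<And>k i v. k \<in> ghost_cells q K \<Longrightarrow> v \<in> V \<Longrightarrow> f_relax k i v \<ge> 0"
    and transport: "\<And>k i v. k \<in> {0..int K} \<Longrightarrow> v \<in> V \<Longrightarrow>
          f_new k i v = transport_step q dt dx (v $ 1) (\<lambda>l. f_relax l i v) k"
    and cfl: "cfl_condition q V dt dx"
    and f_nonneg: "\<And>k i v. k \<in> {0..int K} \<Longrightarrow> v \<in> V \<Longrightarrow> f k i v \<ge> 0"
  shows "\<forall>k\<in>{0..int K}. \<forall>i. \<forall>v\<in>V. f_new k i v \<ge> 0"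
proof (intro ballI allI)
  fix k i v
  assume k: "k \<in> {0..int K}" and v: "v \<in> V"
  \<comment> \<open>One layer around the grid suffices for both fluxes: values two cells away enter
    only through limiters, which the jumps next to cell \<open>k\<close> control whatever those
    values are.\<close>
  have relax_nonneg: "f_relax l i v \<ge> 0" if "l \<in> {-1..int K + 1}" for l
  proof (cases "l \<in> {0..int K}")
    case True
    then show ?thesis
      using relaxation_step_nonneg[of dt "\<nu> l" i v "f l" V m]
        relaxation[of l v i] nu_nonneg[of l v] f_nonneg[of l v i] v dt_pos by simp
  next
    case False
    with that have "l \<in> ghost_cells q K" by (cases q) auto
    then show ?thesis using v by (rule ghost_nonneg)
  qed
  have "dt / dx * \<bar>v $ 1\<bar> \<le> cfl_const q"
    using cfl_condition_pointwise[OF V_bdd v _ dx_pos cfl] dt_pos by simp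
  then have "transport_step q dt dx (v $ 1) (\<lambda>l. f_relax l i v) k \<ge> 0"
    using k dt_pos dx_pos by (intro transport_step_nonneg relax_nonneg) auto
  then show "f_new k i v \<ge> 0"
    using transport[OF k v] by simp
qed

end
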